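(* Let $B\ge1$ be a fixed real number. There are constants $C_B,C_B'$, depending only on $B$, with the following properties. (a) If $j\ge1$ is an integer that is not a square, $M\ge2$, and the dyadic interval $M<k\le2M$ contains an integer point $k$ with $k^2>j$, then $$\sum_{\substack{M<k\le2M\\ k^2>j}}\tau(k^2-j)^B\ll_B M(\log(2M))^{C_B}\,\mathfrak D_{C_B'}(j),$$ with implied constant depending only on $B$. (b) In the case $B=1$, for such $j$ and $M$ one has, with an absolute implied constant, $$\sum_{\substack{M<k\le2M\\ k^2>j}}\tau(k^2-j)\ll M\log(2M)\,\mathfrak D_{C_1'}(j)\,L_{2M}(1,\chi_j).$$
   Context: $\tau(n)$ is the number of positive divisors of $n$; $p$ denotes primes; sums over $k$ are over integers. For $C\ge0$ and a positive integer $n$, $$\mathfrak D_C(n)=\prod_{p\mid 2n}\left(1+\frac1p\right)^C.$$ For a real quadratic character $\chi$ and $M\ge2$, $$L_M(1,\chi)=\prod_{p\le M}\left(1-\frac{\chi(p)}p\right)^{-1}.$$ For a nonsquare positive integer $j$, $\chi_j$ is the primitive quadratic character attached to the squarefree kernel $s$ of $j$ (where $j=su^2$ with $s>1$ squarefree), i.e. the primitive real character attached to $\mathbb Q(\sqrt s)$; for primes $p\nmid 2j$ this means $\chi_j(p)=\left(\frac jp\right)$ (Legendre symbol). *)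

theory Defs
  imports Complex_Main "HOL-Number_Theory.Number_Theory"
    "HOL-Computational_Algebra.Computational_Algebra"
begin

definition tau :: "nat \<Rightarrow> nat" where
  "tau n = card {d. d dvd n}"

definition frakD :: "real \<Rightarrow> nat \<Rightarrow> real" where
  "frakD C n = (\<Prod>p\<in>prime_factors (2 * n). (1 + 1 / real p) powr C)"

text \<open>
  Truncated Euler product at \<open>s = 1\<close>. The cutoff is real; a character is given by its
  values on the natural numbers.
\<close>

definition L_trunc :: "real \<Rightarrow> (nat \<Rightarrow> int) \<Rightarrow> real" where
  "L_trunc M \<chi> = (\<Prod>p\<in>{p::nat. prime p \<and> real p \<le> M}. inverse (1 - real_of_int (\<chi> p) / real p))"

text \<open>
  The Kronecker symbol, first with a prime and then with an arbitrary natural number as lower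
  argument. The library's \<^const>\<open>Legendre\<close> is the right symbol for odd primes only.
\<close>

definition kronecker_prime :: "int \<Rightarrow> nat \<Rightarrow> int" where
  "kronecker_prime D p =
     (if p = 2 then if even D then 0 else if D mod 8 = 1 \<or> D mod 8 = 7 then 1 else -1
      else Legendre D (int p))"

definition kronecker :: "int \<Rightarrow> nat \<Rightarrow> int" where
  "kronecker D n =
     (if n = 0 then if \<bar>D\<bar> = 1 then 1 else 0
      else \<Prod>p\<in>prime_factors n. kronecker_prime D p ^ multiplicity p n)"

text \<open>Discriminant of the real quadratic field \<open>\<rat>(\<surd>s)\<close>, for squarefree \<open>s > 1\<close>.\<close>

definition quad_disc :: "nat \<Rightarrow> int" where
  "quad_disc s = (if s mod 4 = 1 then int s else 4 * int s)"

text \<open>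
  For nonsquare \<open>j\<close>, \<open>chi j\<close> is the primitive real character attached to \<open>\<rat>(\<surd>s)\<close>, where
  \<open>j = s u\<^sup>2\<close> with \<open>s > 1\<close> squarefree: it is the Kronecker symbol of the field discriminant.
  As the discriminant is positive, this character is even, so nothing is lost by restricting
  it to natural numbers.
\<close>

definition chi :: "nat \<Rightarrow> nat \<Rightarrow> int" where
  "chi j = kronecker (quad_disc (squarefree_part j))"

lemma Legendre_mult_square:
  assumes "prime p" "\<not> p dvd c"
  shows "Legendre (a * c\<^sup>2) p = Legendre a p"
proof -
  have pc: "prime_elem p" using assms(1) by (rule prime_imp_prime_elem)
  have "coprime c p"
    using assms prime_imp_coprime coprime_commute by blast
  then obtain d where d: "[c * d = 1] (mod p)"
    using cong_solve_coprime_int by blast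
  have z: "[a * c\<^sup>2 = 0] (mod p) \<longleftrightarrow> [a = 0] (mod p)"
    using assms pc by (auto simp: cong_0_iff prime_elem_dvd_mult_iff prime_elem_dvd_power_iff)
  have q: "QuadRes p (a * c\<^sup>2) \<longleftrightarrow> QuadRes p a"
  proof
    assume "QuadRes p a"
    then obtain y where "[y\<^sup>2 = a] (mod p)" by (auto simp: QuadRes_def)
    then have "[(y * c)\<^sup>2 = a * c\<^sup>2] (mod p)"
      by (simp add: power_mult_distrib cong_mult)
    then show "QuadRes p (a * c\<^sup>2)" by (auto simp: QuadRes_def)
  next
    assume "QuadRes p (a * c\<^sup>2)"
    then obtain y where "[y\<^sup>2 = a * c\<^sup>2] (mod p)" by (auto simp: QuadRes_def)
    then have "[y\<^sup>2 * d\<^sup>2 = a * c\<^sup>2 * d\<^sup>2] (mod p)" by (rule cong_mult) simp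
    moreover have "[a * (c * d)\<^sup>2 = a * 1\<^sup>2] (mod p)"
      using d by (intro cong_mult cong_pow) auto
    ultimately have "[(y * d)\<^sup>2 = a] (mod p)"
      by (metis (no_types, lifting) cong_trans mult.assoc mult.right_neutral power_mult_distrib power_one)
    then show "QuadRes p a" by (auto simp: QuadRes_def)
  qed
  show ?thesis unfolding Legendre_def z q ..
qed

lemma chi_eq_Legendre:
  assumes "prime p" "\<not> p dvd 2 * j"
  shows "chi j p = Legendre (int j) (int p)"
proof -
  have p2: "p \<noteq> 2" and pj: "\<not> p dvd j" using assms by auto
  define s u where "s = squarefree_part j" and "u = square_part j"
  have j: "j = s * u\<^sup>2"
    using squarefree_decompose[of j] by (simp add: s_def u_def)
  have pu: "\<not> int p dvd int u"
    using pj j assms(1) by (auto simp: power2_eq_square)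
  have p': "\<not> int p dvd 2"
    using p2 assms(1) primes_dvd_imp_eq two_is_prime_nat
    by (metis int_dvd_int_iff of_nat_numeral)
  have "Legendre (int s * 2\<^sup>2) (int p) = Legendre (int s) (int p)"
    using assms(1) p' by (intro Legendre_mult_square) auto
  moreover have "Legendre (int s * (int u)\<^sup>2) (int p) = Legendre (int s) (int p)"
    using assms(1) pu by (intro Legendre_mult_square) auto
  ultimately have "Legendre (quad_disc s) (int p) = Legendre (int j) (int p)"
    by (simp add: quad_disc_def j mult.commute)
  then show ?thesis
    using assms(1) p2 prime_gt_0_nat[of p]
    by (simp add: chi_def kronecker_def kronecker_prime_def s_def prime_factorization_prime)
qed

end

theory Submission
  imports Defs "HOL-Real_Asymp.Real_Asymp"
begin

text \<open>
  The numbers \<open>n = k\<^sup>2 - j\<close> in question are at most \<open>4 M\<^sup>2\<close>, so a divisor \<open>d\<close> of \<open>n\<close> with \<open>d\<^sup>2 \<le> n\<close> is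
  at most \<open>2 M\<close>, which is comparable with the length of the interval of summation. Both bounds come
  from dominating the summand by a sum over such small divisors:

  \<^item> \<open>\<tau>(n) \<le> 2 #{d | n : d\<^sup>2 \<le> n}\<close>, because divisors come in pairs
    (\<open>tau_le_small_divisors\<close>);

  \<^item> some \<open>d | n\<close> with \<open>d\<^sup>2 \<le> n\<close> satisfies \<open>\<tau>(n) \<le> 2 \<tau>(d)\<^sup>2\<close>
    (\<open>tau_le_tau_small_divisor\<close>), so that \<open>\<tau>(n)\<^sup>B\<close> is at most \<open>2\<^sup>B\<close> times the sum of
    \<open>\<tau>(d)\<close> to the power \<open>2B\<close> over these small divisors.

  Let \<open>\<rho>(d)\<close> be the number of square roots of \<open>j\<close> modulo \<open>d\<close>. For \<open>d \<le> 2 M\<close> the number of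
  \<open>k\<close> with \<open>d | k\<^sup>2 - j\<close> is at most \<open>\<rho>(d) (M/d + 1) \<le> 3 M \<rho>(d)/d\<close>. After exchanging the sums
  there remains \<open>M \<Sum> \<tau>(d)\<^sup>c \<rho>(d)/d\<close> over \<open>d \<le> 2 M\<close>, with \<open>c = 2 B\<close> or \<open>c = 0\<close>. All
  factors are submultiplicative, so this is at most a product of local factors over the primes up to
  \<open>2 M\<close> (\<open>window_sum_le_euler_product\<close>).

  At every prime \<open>\<rho>(p\<^sup>m) \<le> 2 p\<^bsup>m div 2\<^esup>\<close>, so that the local factor is \<open>1 + O(1/p)\<close> uniformly in
  \<open>j\<close> (\<open>local_factor_le\<close>). With Mertens' bound for \<open>\<Sum> 1/p\<close> this gives a power of
  \<open>log(2M)\<close>, hence (a).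

  For (b) the exponent of the logarithm has to be \<open>1\<close>. If \<open>p\<close> does not divide \<open>2 j\<close>, then
  \<open>\<rho>(p\<^sup>m) \<le> 1 + \<chi>\<^sub>j(p)\<close> and the local factor is at most
  \<open>(1 - 1/p)\<^sup>-\<^sup>1 (1 - \<chi>\<^sub>j(p)/p)\<^sup>-\<^sup>1\<close> without any loss (\<open>unramified_factor_le\<close>). At the primes
  dividing \<open>2 j\<close> the loss is a power of \<open>1 + 1/p\<close> (\<open>ramified_factor_le\<close>), and these powers make up
  \<open>frakD\<close>. The product of the first factors is \<open>O(log(2M))\<close> by Mertens
  (\<open>mertens_product_le\<close>), and that of the second ones is \<open>L\<close> truncated at \<open>2 M\<close>.
\<close>

abbreviation primes_upto :: "nat \<Rightarrow> nat set" where
  "primes_upto n \<equiv> {p. prime p \<and> p \<le> n}"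

section \<open>The divisor function and small divisors\<close>

lemma tau_mult_le:
  assumes "a > 0" "b > 0"
  shows "tau (a * b) \<le> tau a * tau b"
proof -
  have "{d. d dvd a * b} \<subseteq> (\<lambda>(x, y). x * y) ` ({d. d dvd a} \<times> {d. d dvd b})"
    by (auto dest!: division_decomp)
  moreover have fin: "finite ({d. d dvd a} \<times> {d. d dvd b})"
    using assms by simp
  ultimately have "tau (a * b) \<le> card ({d. d dvd a} \<times> {d. d dvd b})"
    unfolding tau_def by (meson card_image_le card_mono finite_imageI le_trans)
  then show ?thesis by (simp add: tau_def card_cartesian_product)
qed

lemma tau_prime_power:
  assumes "prime p"
  shows "tau (p ^ m) = m + 1"
proof -
  have "{d. d dvd p ^ m} = (\<lambda>i. p ^ i) ` {..m}"
    using assms by (auto simp: divides_primepow_nat le_imp_power_dvd)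
  moreover have "inj_on (\<lambda>i. p ^ i) {..m}"
    using prime_gt_1_nat[OF assms] by (auto simp: inj_on_def)
  ultimately show ?thesis by (simp add: tau_def card_image)
qed

text \<open>
  The involution \<open>d \<mapsto> n/d\<close> carries the divisors above the square root of \<open>n\<close> to those below it.
\<close>

lemma tau_le_small_divisors:
  assumes "n > 0"
  shows "tau n \<le> 2 * card {d. d dvd n \<and> d\<^sup>2 \<le> n}"
proof -
  let ?S = "{d. d dvd n \<and> d\<^sup>2 \<le> n}"
  have fin: "finite ?S" using assms by simp
  have "{d. d dvd n} \<subseteq> ?S \<union> (\<lambda>d. n div d) ` ?S"
  proof
    fix d assume "d \<in> {d. d dvd n}"
    then obtain e where e: "n = d * e" by auto
    show "d \<in> ?S \<union> (\<lambda>d. n div d) ` ?S"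
    proof (cases "d \<le> e")
      case True
      then show ?thesis using e by (auto simp: power2_eq_square)
    next
      case False
      then have "e \<in> ?S" "d = n div e" using e assms by (auto simp: power2_eq_square)
      then show ?thesis by blast
    qed
  qed
  then have "tau n \<le> card (?S \<union> (\<lambda>d. n div d) ` ?S)"
    unfolding tau_def using fin by (intro card_mono) auto
  also have "\<dots> \<le> card ?S + card ((\<lambda>d. n div d) ` ?S)" by (rule card_Un_le)
  also have "\<dots> \<le> 2 * card ?S" using card_image_le[OF fin, of "\<lambda>d. n div d"] by simp
  finally show ?thesis .
qed

text \<open>
  If \<open>d\<close> is the largest divisor with \<open>d\<^sup>2 \<le> n\<close> and \<open>p\<close> is a prime factor of \<open>n/d\<close>, then \<open>d p\<close>
  exceeds the square root of \<open>n\<close>, so the complementary divisor \<open>e\<close> in \<open>n = d p e\<close> lies below it.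
  Then \<open>\<tau>(n) \<le> 2 \<tau>(d) \<tau>(e)\<close>, and the better of \<open>d\<close> and \<open>e\<close> will do.
\<close>

lemma tau_le_tau_small_divisor:
  assumes "n > 0"
  shows "\<exists>d. d dvd n \<and> d\<^sup>2 \<le> n \<and> tau n \<le> 2 * (tau d)\<^sup>2"
proof -
  let ?S = "{d. d dvd n \<and> d\<^sup>2 \<le> n}"
  have fin: "finite ?S" using assms by simp
  have ne: "1 \<in> ?S" using assms by simp
  define d where "d = Max ?S"
  have "d \<in> ?S" unfolding d_def using fin ne by (intro Max_in) blast+
  then have d: "d dvd n" "d\<^sup>2 \<le> n" by auto
  have dmax: "e \<le> d" if "e dvd n" "e\<^sup>2 \<le> n" for e
    unfolding d_def using that fin by (intro Max_ge) auto
  obtain m where m: "n = d * m" using d(1) by auto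
  show ?thesis
  proof (cases "m = 1")
    case True
    then have "n = 1" using m d(2) assms by (simp add: power2_eq_square)
    then show ?thesis by (intro exI[of _ 1]) (simp add: tau_def)
  next
    case False
    then obtain p where p: "prime p" "p dvd m" using prime_factor_nat by blast
    then obtain e where e: "m = p * e" by auto
    have pos: "d > 0" "p > 0" "e > 0" using assms m e by auto
    have n: "n = (d * p) * e" using m e by simp
    have "(d * p)\<^sup>2 > n"
    proof (rule ccontr)
      assume "\<not> (d * p)\<^sup>2 > n"
      then have "d * p \<le> d" by (intro dmax) (auto simp: n)
      then show False using pos prime_gt_1_nat[OF p(1)] by simp
    qed
    then have "d * p > e" using pos n by (simp add: power2_eq_square)
    then have e2: "e dvd n" "e\<^sup>2 \<le> n" using n by (auto simp: power2_eq_square)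
    have "tau n \<le> tau (d * p) * tau e" unfolding n using pos by (intro tau_mult_le) auto
    also have "\<dots> \<le> tau d * tau p * tau e" using pos by (intro mult_right_mono tau_mult_le) auto
    also have "tau p = 2" using tau_prime_power[OF p(1), of 1] by simp
    finally have t: "tau n \<le> 2 * (tau d * tau e)" by (simp add: ac_simps)
    show ?thesis
    proof (cases "tau d \<le> tau e")
      case True
      then have "tau d * tau e \<le> (tau e)\<^sup>2" by (simp add: power2_eq_square)
      then show ?thesis using t e2 by (intro exI[of _ e]) linarith
    next
      case False
      then have "tau d * tau e \<le> (tau d)\<^sup>2" by (simp add: power2_eq_square)
      then show ?thesis using t d by (intro exI[of _ d]) linarith
    qed
  qed
qed

lemma tau_powr_le_small_divisor_sum:
  assumes "n > 0" "B \<ge> 0"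
  shows "real (tau n) powr B \<le> 2 powr B * (\<Sum>d | d dvd n \<and> d\<^sup>2 \<le> n. real (tau d) powr (2 * B))"
proof -
  obtain d where d: "d dvd n" "d\<^sup>2 \<le> n" "tau n \<le> 2 * (tau d)\<^sup>2"
    using tau_le_tau_small_divisor[OF assms(1)] by blast
  have "real (tau n) \<le> real (2 * (tau d)\<^sup>2)" using d(3) by (simp only: of_nat_le_iff)
  then have "real (tau n) powr B \<le> (2 * (real (tau d))\<^sup>2) powr B"
    using assms(2) by (intro powr_mono2) simp_all
  also have "\<dots> = 2 powr B * ((real (tau d))\<^sup>2) powr B" by (simp add: powr_mult)
  also have "((real (tau d))\<^sup>2) powr B = real (tau d) powr (2 * B)"
    by (simp only: power2_eq_square powr_mult mult_2 powr_add of_nat_0_le_iff)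
  also have "real (tau d) powr (2 * B) \<le> (\<Sum>d | d dvd n \<and> d\<^sup>2 \<le> n. real (tau d) powr (2 * B))"
    using d assms(1) by (intro member_le_sum) auto
  finally show ?thesis by simp
qed

section \<open>Finite Euler products\<close>

text \<open>
  Splitting off the full power of one prime \<open>q\<close> from \<open>n\<close> maps the numbers composed of primes in
  \<open>insert q P\<close> injectively to pairs of an exponent and a number composed of primes in \<open>P\<close>. The
  exponents stay below \<open>N\<close> since \<open>m < q\<^sup>m \<le> n\<close>.
\<close>

lemma sum_smooth_le_prod:
  fixes f :: "nat \<Rightarrow> real"
  assumes "finite P" "\<And>p. p \<in> P \<Longrightarrow> prime p"
    and nonneg: "\<And>n. f n \<ge> 0" and one: "f 1 = 1"
    and submult: "\<And>a b. a > 0 \<Longrightarrow> b > 0 \<Longrightarrow> coprime a b \<Longrightarrow> f (a * b) \<le> f a * f b"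
  shows "(\<Sum>n | n \<in> {1..N} \<and> prime_factors n \<subseteq> P. f n) \<le> (\<Prod>p\<in>P. \<Sum>m\<le>N. f (p ^ m))"
  using assms(1,2)
proof (induction P rule: finite_induct)
  case empty
  have "{n \<in> {1..N}. prime_factors n \<subseteq> {}} \<subseteq> {1}"
    by (auto simp: prime_factorization_empty_iff)
  then have "(\<Sum>n | n \<in> {1..N} \<and> prime_factors n \<subseteq> {}. f n) \<le> (\<Sum>n\<in>{1}. f n)"
    by (intro sum_mono2) (auto simp: nonneg)
  then show ?case using one by simp
next
  case (insert q P)
  have q: "prime q" using insert by simp
  let ?S = "\<lambda>P. {n \<in> {1..N}. prime_factors n \<subseteq> P}"
  let ?\<phi> = "\<lambda>n. (multiplicity q n, n div q ^ multiplicity q n)"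
  let ?h = "\<lambda>(m, n). f (q ^ m) * f n"
  have decomp: "n = q ^ multiplicity q n * (n div q ^ multiplicity q n)" for n
    by (simp add: multiplicity_dvd)
  have inj: "inj_on ?\<phi> (?S (insert q P))"
    by (rule inj_onI) (metis decomp prod.inject)
  have split: "?\<phi> n \<in> {..N} \<times> ?S P \<and> f n \<le> ?h (?\<phi> n)" if n: "n \<in> ?S (insert q P)" for n
  proof -
    define m r where "m = multiplicity q n" and "r = n div q ^ m"
    have nmr: "n = q ^ m * r" using decomp[of n] by (simp add: m_def r_def)
    have "n > 0" using n by simp
    then have pos: "n > 0" "r > 0" using nmr by (metis gr0I mult_0_right)+
    have ndvd: "\<not> q dvd r"
      unfolding r_def m_def using pos q
      by (metis multiplicity_decompose not_prime_unit less_numeral_extra(3))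
    have "m < q ^ m" using prime_gt_1_nat[OF q] by (simp add: power_gt_expt)
    also have "\<dots> \<le> n" using nmr pos by simp
    finally have mN: "m \<le> N" using n by simp
    have "r \<le> n" using nmr pos prime_gt_0_nat[OF q] by simp
    have "prime_factors r \<subseteq> prime_factors n"
      using pos nmr by (intro dvd_prime_factors) auto
    moreover have "q \<notin> prime_factors r" using ndvd by auto
    ultimately have "r \<in> ?S P" using n pos \<open>r \<le> n\<close> by auto
    moreover have "coprime (q ^ m) r"
      using q ndvd by (simp add: prime_imp_coprime)
    then have "f n \<le> f (q ^ m) * f r"
      using submult[of "q ^ m" r] nmr pos prime_gt_0_nat[OF q] by simp
    ultimately show ?thesis using mN unfolding m_def[symmetric] r_def[symmetric] by simp
  qed
  have "(\<Sum>n\<in>?S (insert q P). f n) \<le> (\<Sum>n\<in>?S (insert q P). ?h (?\<phi> n))"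
    by (rule sum_mono) (use split in blast)
  also have "\<dots> = sum ?h (?\<phi> ` ?S (insert q P))"
    by (subst sum.reindex[OF inj]) (simp only: o_def)
  also have "\<dots> \<le> sum ?h ({..N} \<times> ?S P)"
  proof (rule sum_mono2)
    show "?\<phi> ` ?S (insert q P) \<subseteq> {..N} \<times> ?S P" using split by (intro image_subsetI) blast
  qed (auto simp: nonneg)
  also have "\<dots> = (\<Sum>m\<le>N. f (q ^ m)) * (\<Sum>n\<in>?S P. f n)"
    by (simp add: sum.cartesian_product[symmetric] sum_product)
  also have "\<dots> \<le> (\<Sum>m\<le>N. f (q ^ m)) * (\<Prod>p\<in>P. \<Sum>m\<le>N. f (p ^ m))"
    using insert by (intro mult_left_mono sum_nonneg nonneg) auto
  finally show ?case using insert by simp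
qed

lemma sum_le_euler_product:
  fixes f :: "nat \<Rightarrow> real"
  assumes "\<And>n. f n \<ge> 0" "f 1 = 1"
    and "\<And>a b. a > 0 \<Longrightarrow> b > 0 \<Longrightarrow> coprime a b \<Longrightarrow> f (a * b) \<le> f a * f b"
  shows "(\<Sum>n=1..N. f n) \<le> (\<Prod>p\<in>primes_upto N. \<Sum>m\<le>N. f (p ^ m))"
proof -
  have eq: "{n. n \<in> {1..N} \<and> prime_factors n \<subseteq> primes_upto N} = {1..N}"
    by (auto simp: in_prime_factors_iff dest!: dvd_imp_le)
  have "(\<Sum>n | n \<in> {1..N} \<and> prime_factors n \<subseteq> primes_upto N. f n)
          \<le> (\<Prod>p\<in>primes_upto N. \<Sum>m\<le>N. f (p ^ m))"
    by (rule sum_smooth_le_prod) (use assms in \<open>auto\<close>)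
  then show ?thesis unfolding eq .
qed

section \<open>Square roots modulo prime powers\<close>

definition sqrts_mod :: "int \<Rightarrow> nat \<Rightarrow> int set" where
  "sqrts_mod a d = {x. 0 \<le> x \<and> x < int d \<and> [x\<^sup>2 = a] (mod int d)}"

definition rho :: "int \<Rightarrow> nat \<Rightarrow> nat" where
  "rho a d = card (sqrts_mod a d)"

lemma finite_sqrts_mod [simp]: "finite (sqrts_mod a d)"
  by (rule finite_subset[of _ "{0..<int d}"]) (auto simp: sqrts_mod_def)

lemma rho_1 [simp]: "rho a (Suc 0) = 1"
proof -
  have "sqrts_mod a (Suc 0) = {0}" by (auto simp: sqrts_mod_def)
  then show ?thesis by (simp add: rho_def)
qed

text \<open>
  A square root modulo \<open>d e\<close> is determined by its residues modulo \<open>d\<close> and \<open>e\<close>, by the Chinese remainder theorem.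
\<close>

lemma rho_mult_le:
  assumes "d > 0" "e > 0" "coprime d e"
  shows "rho a (d * e) \<le> rho a d * rho a e"
proof -
  let ?R = "sqrts_mod a"
  let ?\<phi> = "\<lambda>x. (x mod int d, x mod int e)"
  have "inj_on ?\<phi> (?R (d * e))"
  proof (rule inj_onI)
    fix x y assume x: "x \<in> ?R (d * e)" and y: "y \<in> ?R (d * e)" and eq: "?\<phi> x = ?\<phi> y"
    then have "[x = y] (mod int d * int e)"
      using assms(3) by (intro coprime_cong_mult) (auto simp: Cong.cong_def)
    then show "x = y" using x y by (simp add: Cong.cong_def sqrts_mod_def)
  qed
  moreover have "?\<phi> ` ?R (d * e) \<subseteq> ?R d \<times> ?R e"
  proof -
    have "[(x mod int d)\<^sup>2 = a] (mod int d)" if "[x\<^sup>2 = a] (mod int d * int e)" for x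
      using cong_modulus_mult[OF that] by (simp add: Cong.cong_def power_mod)
    moreover have "[(x mod int e)\<^sup>2 = a] (mod int e)" if "[x\<^sup>2 = a] (mod int d * int e)" for x
      using cong_modulus_mult[of "x\<^sup>2" a "int e" "int d"] that
      by (simp add: Cong.cong_def power_mod mult.commute)
    ultimately show ?thesis using assms by (auto simp: sqrts_mod_def)
  qed
  moreover have "finite (?R d \<times> ?R e)" by simp
  ultimately have "card (?R (d * e)) \<le> card (?R d \<times> ?R e)"
    by (meson card_inj_on_le)
  then show ?thesis by (simp add: rho_def card_cartesian_product)
qed

text \<open>
  If both \<open>p\<close>-adic valuations were below \<open>h\<close>, their sum would be at most \<open>2 h - 2 < m\<close>.
\<close>

lemma prime_power_dvd_mult_cases:
  fixes u v :: int
  assumes "prime p" "p ^ m dvd u * v" "2 * h \<le> m + 1"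
  shows "p ^ h dvd u \<or> p ^ h dvd v"
proof (rule ccontr)
  assume neg: "\<not> ?thesis"
  then have nz: "u \<noteq> 0" "v \<noteq> 0" by auto
  have u: "\<not> is_unit p" using assms(1) by auto
  have "m \<le> multiplicity p (u * v)"
    using assms nz u power_dvd_iff_le_multiplicity[of "u * v" p m] by auto
  also have "\<dots> = multiplicity p u + multiplicity p v"
    using assms(1) nz by (intro prime_elem_multiplicity_mult_distrib) auto
  finally have "m \<le> multiplicity p u + multiplicity p v" .
  moreover have "multiplicity p u < h" "multiplicity p v < h"
    using neg nz u by (auto simp: multiplicity_dvd' not_less power_dvd_iff_le_multiplicity)
  ultimately show False using assms(3) by linarith
qed

text \<open>
  Two square roots \<open>x\<close>, \<open>y\<close> of the same number satisfy \<open>p\<^sup>m | (x - y) (x + y)\<close>, hence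
  \<open>x \<equiv> y\<close> or \<open>x \<equiv> -y\<close> modulo \<open>p\<close> to the power \<open>\<lceil>m/2\<rceil>\<close>. Each of these two classes
  contains \<open>p\<^bsup>m div 2\<^esup>\<close> residues modulo \<open>p\<^sup>m\<close>. The bound is independent of the power of \<open>p\<close> that divides \<open>a\<close>.
\<close>

lemma rho_prime_power_le:
  assumes "prime p"
  shows "rho a (p ^ m) \<le> 2 * p ^ (m div 2)"
proof (cases "sqrts_mod a (p ^ m) = {}")
  case True
  then show ?thesis by (simp only: rho_def) simp
next
  case False
  let ?R = "sqrts_mod a (p ^ m)"
  from False obtain y where y: "[y\<^sup>2 = a] (mod int (p ^ m))" by (auto simp: sqrts_mod_def)
  define q r where "q = int p ^ (m - m div 2)" and "r = int p ^ (m div 2)"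
  have qr: "int (p ^ m) = q * r" by (simp add: q_def r_def flip: power_add)
  have pos: "q > 0" "r > 0" using prime_gt_0_nat[OF assms] by (auto simp: q_def r_def)
  let ?T = "\<lambda>c. {x \<in> {0..<q * r}. x mod q = c}"
  have T: "card (?T c) \<le> nat r" for c
  proof -
    have "inj_on (\<lambda>x. x div q) (?T c)"
      by (rule inj_onI) (metis (mono_tags, lifting) mem_Collect_eq mult_div_mod_eq)
    moreover have "x div q < r" if "x < q * r" for x
    proof (rule ccontr)
      assume "\<not> x div q < r"
      then have "q * r \<le> q * (x div q)" using pos by simp
      also have "\<dots> \<le> x" using pos mult_div_mod_eq[of q x] pos_mod_sign[of q x] by linarith
      finally show False using that by simp
    qed
    then have "(\<lambda>x. x div q) ` ?T c \<subseteq> {0..<r}"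
      using pos by (auto simp: pos_imp_zdiv_nonneg_iff)
    ultimately show ?thesis using card_inj_on_le[of "\<lambda>x. x div q" "?T c" "{0..<r}"] by simp
  qed
  have fin: "finite (?T c)" for c
    by (rule finite_subset[of _ "{0..<q * r}"]) auto
  have "?R \<subseteq> ?T (y mod q) \<union> ?T ((- y) mod q)"
  proof
    fix x assume x: "x \<in> ?R"
    then have "[x\<^sup>2 = y\<^sup>2] (mod int p ^ m)" using y by (auto simp: Cong.cong_def sqrts_mod_def)
    then have "int p ^ m dvd (x - y) * (x + y)"
      by (simp add: cong_iff_dvd_diff power2_eq_square algebra_simps)
    then have "q dvd x - y \<or> q dvd x + y"
      unfolding q_def using assms by (intro prime_power_dvd_mult_cases[where m = m]) auto
    then have "[x = y] (mod q) \<or> [x = - y] (mod q)" by (simp add: cong_iff_dvd_diff)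
    then show "x \<in> ?T (y mod q) \<union> ?T ((- y) mod q)"
      using x qr by (auto simp: Cong.cong_def sqrts_mod_def)
  qed
  then have "rho a (p ^ m) \<le> card (?T (y mod q) \<union> ?T ((- y) mod q))"
    unfolding rho_def by (intro card_mono finite_UnI fin)
  also have "\<dots> \<le> card (?T (y mod q)) + card (?T ((- y) mod q))" by (rule card_Un_le)
  also have "\<dots> \<le> 2 * nat r" using T[of "y mod q"] T[of "(- y) mod q"] by linarith
  also have "nat r = p ^ (m div 2)" by (simp add: r_def nat_power_eq)
  finally show ?thesis .
qed

lemma chi_prime_cases:
  assumes "prime p"
  shows "chi j p \<in> {-1, 0, 1}"
  using assms prime_gt_0_nat[OF assms]
  by (auto simp: chi_def kronecker_def kronecker_prime_def Legendre_def prime_factorization_prime)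

text \<open>
  Here \<open>p\<close> cannot divide both \<open>x - y\<close> and \<open>x + y\<close>, so \<open>x \<equiv> y\<close> or \<open>x \<equiv> -y\<close> modulo the full
  power \<open>p\<^sup>m\<close>; and if there is a root at all, then \<open>j\<close> is a quadratic residue modulo \<open>p\<close>.
\<close>

lemma rho_prime_power_le_chi:
  assumes "prime p" "\<not> p dvd 2 * j" "m > 0"
  shows "int (rho (int j) (p ^ m)) \<le> 1 + chi j p"
proof (cases "sqrts_mod (int j) (p ^ m) = {}")
  case True
  then have "rho (int j) (p ^ m) = 0" by (simp only: rho_def) simp
  then show ?thesis using chi_prime_cases[OF assms(1), of j] by auto
next
  case False
  let ?R = "sqrts_mod (int j) (p ^ m)"
  from False obtain y where y: "[y\<^sup>2 = int j] (mod int (p ^ m))" by (auto simp: sqrts_mod_def)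
  have p: "prime (int p)" using assms(1) by simp
  have "int p dvd int (p ^ m)" using assms(3) by simp
  then have yp: "[y\<^sup>2 = int j] (mod int p)" using y by (rule cong_dvd_modulus[rotated])
  have j0: "\<not> int p dvd int j" using assms(2) by auto
  have p2: "\<not> int p dvd 2"
    using assms(2) by (metis dvd_mult2 int_dvd_int_iff of_nat_numeral)
  have py: "\<not> int p dvd y"
    using j0 yp p cong_dvd_iff[OF yp] by (simp add: prime_dvd_power_iff)
  have "chi j p = 1"
    using yp j0 chi_eq_Legendre[OF assms(1,2)]
    by (auto simp: Legendre_def cong_0_iff QuadRes_def)
  moreover have "?R \<subseteq> {y mod int (p ^ m), (- y) mod int (p ^ m)}"
  proof
    fix x assume x: "x \<in> ?R"
    then have "[x\<^sup>2 = y\<^sup>2] (mod int p ^ m)" using y by (auto simp: Cong.cong_def sqrts_mod_def)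
    then have dvd: "int p ^ m dvd (x - y) * (x + y)"
      by (simp add: cong_iff_dvd_diff power2_eq_square algebra_simps)
    have "\<not> (int p dvd x - y \<and> int p dvd x + y)"
    proof
      assume "int p dvd x - y \<and> int p dvd x + y"
      then have "int p dvd (x + y) - (x - y)" using dvd_diff by blast
      then have "int p dvd 2 * y" by simp
      then show False using p p2 py by (simp add: prime_dvd_mult_iff)
    qed
    then have "coprime (int p ^ m) (x - y) \<or> coprime (int p ^ m) (x + y)"
      using p by (auto intro: prime_imp_coprime)
    then have "int p ^ m dvd x - y \<or> int p ^ m dvd x + y"
      using dvd by (auto simp: coprime_dvd_mult_right_iff coprime_dvd_mult_left_iff)
    then have "[x = y] (mod int (p ^ m)) \<or> [x = - y] (mod int (p ^ m))"
      by (simp add: cong_iff_dvd_diff)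
    then show "x \<in> {y mod int (p ^ m), (- y) mod int (p ^ m)}"
      using x by (auto simp: Cong.cong_def sqrts_mod_def)
  qed
  then have "card ?R \<le> card {y mod int (p ^ m), (- y) mod int (p ^ m)}"
    by (intro card_mono) auto
  then have "rho (int j) (p ^ m) \<le> 2"
    unfolding rho_def using card_insert_le_m1[of 2 "{(- y) mod int (p ^ m)}" "y mod int (p ^ m)"]
    by simp
  ultimately show ?thesis by simp
qed

section \<open>Divisors of the values of a quadratic polynomial\<close>

lemma card_residue_class_window_le:
  fixes a b :: real and d r :: int
  assumes "d > 0" "a \<le> b"
  shows "card {k::int. a < of_int k \<and> of_int k \<le> b \<and> k mod d = r} \<le> (b - a) / of_int d + 1"
proof -
  let ?S = "{k::int. a < of_int k \<and> of_int k \<le> b \<and> k mod d = r}"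
  let ?lo = "\<lfloor>(a - r) / d\<rfloor>" and ?hi = "\<lfloor>(b - r) / d\<rfloor>"
  have inj: "inj_on (\<lambda>k. k div d) ?S"
    by (rule inj_onI) (metis (mono_tags, lifting) mem_Collect_eq mult_div_mod_eq)
  have sub: "(\<lambda>k. k div d) ` ?S \<subseteq> {?lo<..?hi}"
  proof
    fix q assume "q \<in> (\<lambda>k. k div d) ` ?S"
    then obtain k where k: "a < of_int k" "of_int k \<le> b" "k mod d = r" "q = k div d" by auto
    have "of_int k = real_of_int d * q + r"
      using k(3,4) mult_div_mod_eq[of d k] by (metis of_int_add of_int_mult)
    then have "(a - r) / d < q" "q \<le> (b - r) / d"
      using k(1,2) assms(1) by (auto simp: field_simps)
    then show "q \<in> {?lo<..?hi}" by (simp add: floor_less_iff le_floor_iff)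
  qed
  have "card ?S \<le> card {?lo<..?hi}"
    using card_inj_on_le[OF inj sub] by simp
  also have "\<dots> = nat (?hi - ?lo)" by simp
  finally have "real (card ?S) \<le> real (nat (?hi - ?lo))" by linarith
  also have "(a - r) / d \<le> (b - r) / d" using assms by (simp add: field_simps)
  then have "?lo \<le> ?hi" by (rule floor_mono)
  then have "real (nat (?hi - ?lo)) = real_of_int ?hi - real_of_int ?lo" by simp
  also have "\<dots> \<le> (b - r) / d - ((a - r) / d - 1)" by linarith
  also have "\<dots> = (b - a) / d + 1" using assms(1) by (simp add: field_simps)
  finally show ?thesis .
qed

lemma card_roots_window_le:
  fixes u v :: real
  assumes "d > 0" "u \<le> v"
  shows "card {k::int. u < of_int k \<and> of_int k \<le> v \<and> int d dvd k\<^sup>2 - a}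
           \<le> rho a d * ((v - u) / d + 1)"
proof -
  let ?R = "sqrts_mod a d"
  let ?W = "\<lambda>x. {k::int. u < of_int k \<and> of_int k \<le> v \<and> k mod int d = x}"
  have fin: "finite (?W x)" for x
    by (rule finite_subset[of _ "{\<lfloor>u\<rfloor>..\<lceil>v\<rceil>}"]) (auto, linarith+)
  have "{k::int. u < of_int k \<and> of_int k \<le> v \<and> int d dvd k\<^sup>2 - a} \<subseteq> (\<Union>x\<in>?R. ?W x)"
    using assms(1) by (auto simp: sqrts_mod_def cong_iff_dvd_diff[symmetric] Cong.cong_def power_mod)
  then have "card {k::int. u < of_int k \<and> of_int k \<le> v \<and> int d dvd k\<^sup>2 - a}
               \<le> card (\<Union>x\<in>?R. ?W x)"
    by (intro card_mono finite_UN_I fin) simp_all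
  also have "\<dots> \<le> (\<Sum>x\<in>?R. card (?W x))" by (rule card_UN_le) simp
  finally have "real (card {k::int. u < of_int k \<and> of_int k \<le> v \<and> int d dvd k\<^sup>2 - a})
                  \<le> (\<Sum>x\<in>?R. real (card (?W x)))"
    unfolding of_nat_sum[symmetric] of_nat_le_iff .
  also have "\<dots> \<le> (\<Sum>x\<in>?R. (v - u) / d + 1)"
  proof (rule sum_mono)
    fix x
    show "real (card (?W x)) \<le> (v - u) / d + 1"
      using card_residue_class_window_le[of "int d" u v x] assms by simp
  qed
  also have "\<dots> = rho a d * ((v - u) / d + 1)" by (simp add: rho_def)
  finally show ?thesis .
qed

text \<open>
  The exchange of summation. A divisor \<open>d\<close> with \<open>d\<^sup>2 \<le> k\<^sup>2 - j\<close> is at most \<open>k \<le> 2 M\<close>, so the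
  error term \<open>1\<close> in the number \<open>M/d + 1\<close> of integers per residue class is at most \<open>2 M/d\<close>.
\<close>

lemma divisor_sum_window_le:
  fixes M :: real and g :: "nat \<Rightarrow> real"
  assumes "M \<ge> 1" "\<And>d. g d \<ge> 0"
  shows "(\<Sum>k\<in>{k::int. M < of_int k \<and> of_int k \<le> 2 * M \<and> k\<^sup>2 > int j}.
            \<Sum>d | d dvd nat (k\<^sup>2 - int j) \<and> d\<^sup>2 \<le> nat (k\<^sup>2 - int j). g d)
         \<le> 3 * M * (\<Sum>d=1..nat \<lfloor>2 * M\<rfloor>. g d * rho (int j) d / d)"
proof -
  let ?W = "{k::int. M < of_int k \<and> of_int k \<le> 2 * M \<and> k\<^sup>2 > int j}"
  let ?N = "nat \<lfloor>2 * M\<rfloor>"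
  let ?D = "\<lambda>d. {k::int. M < of_int k \<and> of_int k \<le> 2 * M \<and> int d dvd k\<^sup>2 - int j}"
  have fin: "finite {k::int. M < of_int k \<and> of_int k \<le> 2 * M \<and> Q k}" for Q
    by (rule finite_subset[of _ "{\<lfloor>M\<rfloor>..\<lceil>2 * M\<rceil>}"]) (auto, linarith+)
  have small: "{d. d dvd nat (k\<^sup>2 - int j) \<and> d\<^sup>2 \<le> nat (k\<^sup>2 - int j)}
                 \<subseteq> {d \<in> {1..?N}. int d dvd k\<^sup>2 - int j}" if k: "k \<in> ?W" for k
  proof
    fix d assume "d \<in> {d. d dvd nat (k\<^sup>2 - int j) \<and> d\<^sup>2 \<le> nat (k\<^sup>2 - int j)}"
    then have d: "d dvd nat (k\<^sup>2 - int j)" "d\<^sup>2 \<le> nat (k\<^sup>2 - int j)" by auto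
    have pos: "nat (k\<^sup>2 - int j) > 0" using k by simp
    then have d0: "d > 0" using d(1) by (auto intro!: Nat.gr0I)
    have "int (d\<^sup>2) \<le> k\<^sup>2 - int j" using d(2) pos by linarith
    then have "(int d)\<^sup>2 \<le> k\<^sup>2" by simp
    moreover have "k \<ge> 0" using k assms(1) by (smt (verit) mem_Collect_eq of_int_0_le_iff)
    ultimately have "int d \<le> k" by (rule power2_le_imp_le)
    then have "real d \<le> 2 * M" using k by (smt (verit) mem_Collect_eq of_int_le_iff of_int_of_nat_eq)
    then have "d \<le> ?N" by linarith
    moreover have "int d dvd k\<^sup>2 - int j"
    proof -
      have "int d dvd int (nat (k\<^sup>2 - int j))" using d(1) by (simp only: of_nat_dvd_iff)
      then show ?thesis using k by simp
    qed
    ultimately show "d \<in> {d \<in> {1..?N}. int d dvd k\<^sup>2 - int j}" using d0 by simp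
  qed
  have "(\<Sum>k\<in>?W. \<Sum>d | d dvd nat (k\<^sup>2 - int j) \<and> d\<^sup>2 \<le> nat (k\<^sup>2 - int j). g d)
          \<le> (\<Sum>k\<in>?W. \<Sum>d\<in>{d \<in> {1..?N}. int d dvd k\<^sup>2 - int j}. g d)"
    using small assms(2) by (intro sum_mono sum_mono2) auto
  also have "\<dots> = (\<Sum>d=1..?N. \<Sum>k\<in>{k \<in> ?W. int d dvd k\<^sup>2 - int j}. g d)"
    using fin by (intro sum.swap_restrict) auto
  also have "\<dots> = (\<Sum>d=1..?N. g d * card {k \<in> ?W. int d dvd k\<^sup>2 - int j})"
    by (simp add: mult.commute)
  also have "\<dots> \<le> (\<Sum>d=1..?N. g d * (rho (int j) d * (3 * M / d)))"
  proof (intro sum_mono mult_left_mono assms(2))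
    fix d assume d: "d \<in> {1..?N}"
    then have d': "real d \<le> 2 * M" "d > 0" by (auto, linarith)
    have "card {k \<in> ?W. int d dvd k\<^sup>2 - int j} \<le> card (?D d)"
      using fin by (intro card_mono) auto
    also have "real (card (?D d)) \<le> rho (int j) d * ((2 * M - M) / d + 1)"
      using d' assms(1) by (intro card_roots_window_le) auto
    also have "\<dots> \<le> rho (int j) d * (3 * M / d)"
      using d' by (intro mult_left_mono) (auto simp: field_simps)
    finally show "card {k \<in> ?W. int d dvd k\<^sup>2 - int j} \<le> rho (int j) d * (3 * M / d)" by simp
  qed
  also have "\<dots> = 3 * M * (\<Sum>d=1..?N. g d * rho (int j) d / d)"
    by (simp add: sum_distrib_left mult_ac)
  finally show ?thesis .
qed

section \<open>Mertens' upper bounds\<close>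

lemma prod_primes_dvd:
  fixes n :: nat
  assumes "finite P" "\<And>p. p \<in> P \<Longrightarrow> prime p" "\<And>p. p \<in> P \<Longrightarrow> p dvd n"
  shows "\<Prod>P dvd n"
  using assms
proof (induction P rule: finite_induct)
  case (insert q P)
  have "coprime q (\<Prod>P)"
    using insert by (intro prod_coprime_right primes_coprime) auto
  then show ?case using insert by (simp add: divides_mult)
qed simp

lemma middle_binomial_le: "(2 * m + 1) choose m \<le> 4 ^ m"
proof -
  have "2 * ((2 * m + 1) choose m) = (\<Sum>k\<in>{m, m + 1}. (2 * m + 1) choose k)"
    using binomial_symmetric[of m "2 * m + 1"] by simp
  also have "\<dots> \<le> (\<Sum>k\<le>2 * m + 1. (2 * m + 1) choose k)"
    by (intro sum_mono2) auto
  also have "\<dots> = 2 * 4 ^ m"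
    by (simp only: choose_row_sum) (simp add: power_mult)
  finally show ?thesis by simp
qed

text \<open>
  Chebyshev's bound by the argument of Erdos: for odd \<open>n = 2 m + 1\<close> the primes in \<open>(m + 1, n]\<close>
  divide a binomial coefficient which is at most \<open>4\<^sup>m\<close>.
\<close>

lemma primorial_le: "\<Prod>(primes_upto n) \<le> 4 ^ n"
proof (induction n rule: less_induct)
  case (less n)
  consider "n < 2" | "n = 2" | "n > 2" "even n" | m where "n = 2 * m + 1" "m > 0"
    by (metis less_2_cases_iff linorder_neqE_nat oddE One_nat_def mult_0_right add_0 gr0I)
  then show ?case
  proof cases
    case 1
    then have "primes_upto n = {}" by (auto dest: prime_ge_2_nat)
    then show ?thesis by (simp only: prod.empty) simp
  next
    case 2
    then have "primes_upto n = {2}" by (auto dest: prime_ge_2_nat)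
    then show ?thesis using 2 by simp
  next
    case 3
    then have "\<not> prime n" using prime_odd_nat by auto
    then have "primes_upto n = primes_upto (n - 1)"
      using 3 by (auto simp: le_less)
    then have "\<Prod>(primes_upto n) \<le> 4 ^ (n - 1)" using less[of "n - 1"] 3 by simp
    also have "\<dots> \<le> 4 ^ n" by (intro power_increasing) auto
    finally show ?thesis .
  next
    case 4
    let ?Q = "{p. prime p \<and> m + 1 < p \<and> p \<le> n}"
    have "p dvd n choose m" if p: "p \<in> ?Q" for p
    proof -
      have "p dvd fact n" using p by (simp add: prime_dvd_fact_iff)
      also have "fact n = fact m * fact (m + 1) * (n choose m)"
        using binomial_fact_lemma[of m n] 4 by simp
      finally show ?thesis
        using p by (simp add: prime_dvd_mult_iff prime_dvd_fact_iff del: fact_Suc)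
    qed
    then have "\<Prod>?Q dvd n choose m" by (intro prod_primes_dvd) auto
    then have "\<Prod>?Q \<le> n choose m" using 4 by (intro dvd_imp_le) auto
    also have "\<dots> \<le> 4 ^ m" using middle_binomial_le 4 by simp
    finally have Q: "\<Prod>?Q \<le> 4 ^ m" .
    have "primes_upto n = primes_upto (m + 1) \<union> ?Q" using 4 by auto
    then have "\<Prod>(primes_upto n) = \<Prod>(primes_upto (m + 1)) * \<Prod>?Q"
      by (simp only:) (intro prod.union_disjoint; force)
    also have "\<dots> \<le> 4 ^ (m + 1) * 4 ^ m" using less[of "m + 1"] 4 Q by (intro mult_mono) auto
    also have "\<dots> = 4 ^ n" using 4 by (simp add: power_add[symmetric])
    finally show ?thesis .
  qed
qed

lemma sum_ln_primes_le: "(\<Sum>p\<in>primes_upto n. ln (real p)) \<le> real n * ln 4"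
proof -
  have "(\<Sum>p\<in>primes_upto n. ln (real p)) = ln (\<Prod>p\<in>primes_upto n. real p)"
    by (intro ln_prod[symmetric]) (auto simp: prime_gt_0_nat)
  also have "(\<Prod>p\<in>primes_upto n. real p) = real (\<Prod>(primes_upto n))" by simp
  also have "ln \<dots> \<le> ln (real (4 ^ n))"
    using primorial_le[of n] by (intro ln_mono) (auto intro!: prod_pos simp: prime_gt_0_nat simp flip: of_nat_prod)
  also have "\<dots> = real n * ln 4" by (simp add: ln_realpow)
  finally show ?thesis .
qed

lemma sum_ln_prime_divisors_le:
  assumes "k > 0" "finite P" "\<And>p. p \<in> P \<Longrightarrow> prime p \<and> p dvd k"
  shows "(\<Sum>p\<in>P. ln (real p)) \<le> ln (real k)"
proof -
  have "(\<Sum>p\<in>P. ln (real p)) = ln (\<Prod>p\<in>P. real p)"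
    using assms by (intro ln_prod[symmetric]) (auto simp: prime_gt_0_nat)
  also have "(\<Prod>p\<in>P. real p) = real (\<Prod>P)" by simp
  also have "\<Prod>P \<le> k" using assms by (intro dvd_imp_le prod_primes_dvd) auto
  then have "ln (real (\<Prod>P)) \<le> ln (real k)"
    using assms by (intro ln_mono) (auto intro!: prod_pos simp: prime_gt_0_nat simp flip: of_nat_prod)
  finally show ?thesis .
qed

text \<open>
  Summing \<open>\<Sum> log p\<close> over the primes \<open>p | k\<close>, which is at most \<open>log k\<close>, over all \<open>k \<le> n\<close>
  counts each prime about \<open>n/p\<close> times. The rounding errors add up to \<open>\<Sum> log p\<close>, which is
  controlled by Chebyshev's bound.
\<close>

lemma sum_ln_over_primes_le:
  assumes "n > 0"
  shows "(\<Sum>p\<in>primes_upto n. ln (real p) / real p) \<le> ln (real n) + ln 4"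
proof -
  have fin: "finite (primes_upto n)" by simp
  have count: "real n / p - 1 \<le> card {k \<in> {1..n}. p dvd k}" if "p > 0" for p :: nat
  proof -
    have "(\<lambda>i. p * i) ` {1..n div p} \<subseteq> {k \<in> {1..n}. p dvd k}"
      using that by (auto simp: less_eq_div_iff_mult_less_eq mult.commute Suc_leI)
    moreover have "inj_on (\<lambda>i. p * i) {1..n div p}" using that by (auto simp: inj_on_def)
    ultimately have "n div p \<le> card {k \<in> {1..n}. p dvd k}"
      using card_inj_on_le[of "\<lambda>i. p * i" "{1..n div p}" "{k \<in> {1..n}. p dvd k}"] by simp
    moreover have "real n / p - 1 \<le> real (n div p)"
      using floor_divide_of_nat_eq[of n p, where ?'a = real] by linarith
    ultimately show ?thesis by linarith
  qed
  have "real n * (\<Sum>p\<in>primes_upto n. ln (real p) / p) - (\<Sum>p\<in>primes_upto n. ln (real p))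
          = (\<Sum>p\<in>primes_upto n. ln (real p) * (real n / p - 1))"
    by (simp add: sum_distrib_left sum_subtractf[symmetric] algebra_simps)
  also have "\<dots> \<le> (\<Sum>p\<in>primes_upto n. ln (real p) * card {k \<in> {1..n}. p dvd k})"
    by (intro sum_mono mult_left_mono count) (auto dest: prime_gt_0_nat)
  also have "\<dots> = (\<Sum>p\<in>primes_upto n. \<Sum>k\<in>{k \<in> {1..n}. p dvd k}. ln (real p))"
    by (simp add: mult.commute)
  also have "\<dots> = (\<Sum>k=1..n. \<Sum>p\<in>{p \<in> primes_upto n. p dvd k}. ln (real p))"
    by (rule sum.swap_restrict[OF fin]) simp
  also have "\<dots> \<le> (\<Sum>k=1..n. ln (real n))"
  proof (rule sum_mono)
    fix k assume k: "k \<in> {1..n}"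
    then have "(\<Sum>p\<in>{p \<in> primes_upto n. p dvd k}. ln (real p)) \<le> ln (real k)"
      by (intro sum_ln_prime_divisors_le) auto
    also have "\<dots> \<le> ln (real n)" using k by simp
    finally show "(\<Sum>p\<in>{p \<in> primes_upto n. p dvd k}. ln (real p)) \<le> ln (real n)" .
  qed
  also have "\<dots> = real n * ln (real n)" by simp
  finally have "real n * (\<Sum>p\<in>primes_upto n. ln (real p) / p) \<le> real n * (ln (real n) + ln 4)"
    using sum_ln_primes_le[of n] by (simp add: algebra_simps)
  then show ?thesis using assms by simp
qed

lemma primes_upto_Suc:
  "primes_upto (Suc n) = (if prime (Suc n) then insert (Suc n) (primes_upto n) else primes_upto n)"
  by (auto simp: le_Suc_eq)

text \<open>
  Partial summation in the form of an induction. With \<open>A(n) = \<Sum> log p/p\<close>, the sum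
  \<open>T(n) = \<Sum> 1/p\<close> is compared with \<open>(A(n) - log 4)/log n + log log n\<close>: the contributions of
  a prime \<open>n + 1\<close> to both sides cancel, and what remains of the step follows from
  \<open>A(n) - log 4 \<le> log n\<close>.
\<close>

lemma sum_inverse_primes_le:
  assumes "n \<ge> 2"
  shows "(\<Sum>p\<in>primes_upto n. 1 / real p) \<le> ln (ln (real n)) + (3 - ln (ln 2))"
proof -
  define A where "A = (\<lambda>n. \<Sum>p\<in>primes_upto n. ln (real p) / real p)"
  define T where "T = (\<lambda>n. \<Sum>p\<in>primes_upto n. 1 / real p)"
  have A: "A n \<le> ln (real n) + ln 4" if "n \<ge> 2" for n
    using sum_ln_over_primes_le[of n] that by (simp add: A_def)
  have ln4: "ln 4 = 2 * ln (2::real)" using ln_realpow[of 2 2] by simp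
  (* The additive constant makes the inequality an equality at n = 2. *)
  have *: "T n \<le> (A n - ln 4) / ln n + ln (ln n) + (2 - ln (ln 2))" using assms
  proof (induction n rule: dec_induct)
    case base
    have "primes_upto 2 = {2}" by (auto dest: prime_ge_2_nat)
    then show ?case by (simp add: A_def T_def ln4 diff_divide_distrib)
  next
    case (step n)
    define l l' where "l = ln (real n)" and "l' = ln (real (Suc n))"
    define a where "a = (if prime (Suc n) then l' / real (Suc n) else 0)"
    have l: "0 < l" "l < l'" using step by (auto simp: l_def l'_def)
    have A': "A (Suc n) = A n + a"
      by (simp add: A_def a_def l'_def primes_upto_Suc)
    have T': "T (Suc n) = T n + a / l'"
      using l by (simp add: T_def a_def primes_upto_Suc)
    have "(A n - ln 4) * (1 / l - 1 / l') \<le> l * (1 / l - 1 / l')"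
      using A[of n] step l by (intro mult_right_mono) (auto simp: l_def frac_le)
    also have "\<dots> = 1 - l / l'" using l by (simp add: field_simps)
    also have "\<dots> \<le> ln l' - ln l"
      using ln_le_minus_one[of "l / l'"] l by (simp add: ln_div)
    finally have "(A n - ln 4) / l + ln l \<le> (A n - ln 4) / l' + ln l'"
      by (simp add: algebra_simps diff_divide_distrib)
    moreover have "T n \<le> (A n - ln 4) / l + ln l + (2 - ln (ln 2))"
      using step.IH by (simp add: l_def)
    ultimately have "T n + a / l' \<le> (A n + a - ln 4) / l' + ln l' + (2 - ln (ln 2))"
      by (simp add: add_divide_distrib diff_divide_distrib)
    then show ?case unfolding A' T' l'_def .
  qed
  have "(A n - ln 4) / ln n \<le> 1" using A[OF assms] assms by (simp add: divide_le_eq)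
  then show ?thesis using * by (simp add: T_def)
qed

lemma sum_inverse_prime_times_pred_le: "(\<Sum>p\<in>primes_upto n. 1 / (real p * (real p - 1))) \<le> 1"
proof (cases "n \<ge> 2")
  case True
  then have "(\<Sum>m=2..n. 1 / (real m * (real m - 1))) = 1 - 1 / real n"
  proof (induction n rule: dec_induct)
    case (step n)
    have "1 / (real (Suc n) * (real (Suc n) - 1)) = 1 / real n - 1 / real (Suc n)"
      using step by (simp add: field_simps)
    then show ?case using step by simp
  qed simp
  moreover have "(\<Sum>p\<in>primes_upto n. 1 / (real p * (real p - 1))) \<le> (\<Sum>m=2..n. 1 / (real m * (real m - 1)))"
    by (intro sum_mono2) (auto dest: prime_ge_2_nat)
  ultimately show ?thesis by (smt (verit) divide_nonneg_nonneg of_nat_0_le_iff)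
next
  case False
  then have "primes_upto n = {}" by (auto dest: prime_ge_2_nat)
  then show ?thesis by (simp only: sum.empty)
qed

text \<open>
  Since \<open>1/(1 - 1/p) = 1 + 1/p + 1/(p (p - 1))\<close>, the product is at most a constant times \<open>exp(\<Sum> 1/p)\<close>.
\<close>

lemma mertens_product_le:
  assumes "n \<ge> 2"
  shows "(\<Prod>p\<in>primes_upto n. inverse (1 - 1 / real p)) \<le> exp (4 - ln (ln 2)) * ln (real n)"
proof -
  have "(\<Prod>p\<in>primes_upto n. inverse (1 - 1 / real p))
          \<le> (\<Prod>p\<in>primes_upto n. exp (1 / real p + 1 / (real p * (real p - 1))))"
  proof (intro prod_mono conjI)
    fix p assume "p \<in> primes_upto n"
    then have p: "real p \<ge> 2" using prime_ge_2_nat[of p] by simp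
    then show "0 \<le> inverse (1 - 1 / real p)" by simp
    have "inverse (1 - 1 / real p) = 1 + (1 / real p + 1 / (real p * (real p - 1)))"
      using p by (simp add: field_simps)
    also have "\<dots> \<le> exp (1 / real p + 1 / (real p * (real p - 1)))" by (rule exp_ge_add_one_self)
    finally show "inverse (1 - 1 / real p) \<le> exp (1 / real p + 1 / (real p * (real p - 1)))" .
  qed
  also have "\<dots> = exp ((\<Sum>p\<in>primes_upto n. 1 / real p) + (\<Sum>p\<in>primes_upto n. 1 / (real p * (real p - 1))))"
    by (simp add: exp_sum sum.distrib[symmetric])
  also have "\<dots> \<le> exp (ln (ln (real n)) + (4 - ln (ln 2)))"
    using sum_inverse_primes_le[OF assms] sum_inverse_prime_times_pred_le[of n] by simp
  also have "\<dots> = exp (4 - ln (ln 2)) * ln (real n)"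
    using assms by (simp add: exp_add)
  finally show ?thesis .
qed

section \<open>Local factors\<close>

text \<open>
  The constant \<open>3/4\<close> is a rational number above the square root of \<open>1/2\<close>; this comparison removes
  the rounding in the exponent.
\<close>

lemma half_power_div2_le: "(1 / 2 :: real) ^ (i div 2) \<le> 2 * (3 / 4) ^ i"
proof (induction i rule: nat_less_induct)
  case (1 i)
  show ?case
  proof (cases "i < 2")
    case True
    then show ?thesis by (auto simp: less_2_cases_iff)
  next
    case False
    then obtain k where k: "i = k + 2" by (metis add.commute le_Suc_ex not_less)
    then have "(1 / 2 :: real) ^ (k div 2) \<le> 2 * (3 / 4) ^ k" using 1 by simp
    then have "(1 / 2) * (1 / 2 :: real) ^ (k div 2) \<le> (9 / 16) * (2 * (3 / 4) ^ k)"
      by (intro mult_mono) auto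
    then show ?thesis using k by (simp add: power2_eq_square)
  qed
qed

lemma summable_power_times_half_power:
  fixes c :: real
  shows "summable (\<lambda>i. real (i + 2) powr c * (1 / 2) ^ (i div 2))"
proof (rule summable_comparison_test)
  show "summable (\<lambda>i. 2 * (real (i + 2) powr c * (3 / 4) ^ i))"
  proof (rule summable_mult, rule summable_comparison_test_bigo)
    show "summable (\<lambda>i. norm ((7 / 8 :: real) ^ i))" by (simp add: summable_geometric)
    show "(\<lambda>i. real (i + 2) powr c * (3 / 4) ^ i) \<in> O(\<lambda>i. (7 / 8) ^ i)" by real_asymp
  qed
  show "\<exists>N. \<forall>n\<ge>N. norm (real (n + 2) powr c * (1 / 2) ^ (n div 2)) \<le> 2 * (real (n + 2) powr c * (3 / 4) ^ n)"
    using half_power_div2_le by (intro exI[of _ 0]) (auto simp: mult_left_mono mult.left_commute[of 2])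
qed

text \<open>
  The term of exponent \<open>m = i + 1\<close> is \<open>(m + 1)\<^sup>c\<close> times at most \<open>2 p\<^bsup>-1 - i div 2\<^esup>\<close>. Taking out
  \<open>2/p\<close> and replacing \<open>p\<close> by \<open>2\<close> in the rest leaves a convergent series that depends only on \<open>c\<close>.
  The constant is a natural number so that Bernoulli's inequality applies to it later.
\<close>

lemma local_factor_le:
  fixes c :: real
  shows "\<exists>K::nat. \<forall>p a N. prime p \<longrightarrow>
           (\<Sum>m\<le>N. real (m + 1) powr c * rho a (p ^ m) / real (p ^ m)) \<le> 1 + K / real p"
proof -
  define s where "s = (\<lambda>i. real (i + 2) powr c * (1 / 2) ^ (i div 2))"
  have summ: "summable s" unfolding s_def by (rule summable_power_times_half_power)
  have s0: "s i \<ge> 0" for i by (simp add: s_def)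
  obtain K :: nat where K: "2 * suminf s \<le> K" using real_arch_simple by blast
  have "(\<Sum>m\<le>N. real (m + 1) powr c * rho a (p ^ m) / real (p ^ m)) \<le> 1 + K / real p"
    if p: "prime p" for p a N
  proof -
    have p2: "real p \<ge> 2" using prime_ge_2_nat[OF p] by simp
    have term_le: "real (Suc i + 1) powr c * rho a (p ^ Suc i) / real (p ^ Suc i) \<le> 2 / p * s i" for i
    proof -
      have exps: "Suc i = Suc i div 2 + Suc (i div 2)" by presburger
      have "rho a (p ^ Suc i) / real (p ^ Suc i) \<le> 2 * real p ^ (Suc i div 2) / real p ^ Suc i"
        using rho_prime_power_le[OF p, of a "Suc i"]
        by (simp only: of_nat_power) (intro divide_right_mono; simp flip: of_nat_power of_nat_mult)
      also have "\<dots> = 2 / real p * (1 / real p) ^ (i div 2)"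
        using p2 by (subst (2) exps) (simp only: power_add, simp add: field_simps)
      also have "\<dots> \<le> 2 / real p * (1 / 2) ^ (i div 2)"
        using p2 by (intro mult_left_mono power_mono frac_le) auto
      finally have "real (i + 2) powr c * (rho a (p ^ Suc i) / real (p ^ Suc i))
                      \<le> real (i + 2) powr c * (2 / real p * (1 / 2) ^ (i div 2))"
        by (rule mult_left_mono) simp
      then show ?thesis by (simp add: s_def mult_ac)
    qed
    have "(\<Sum>m\<le>N. real (m + 1) powr c * rho a (p ^ m) / real (p ^ m))
            = 1 + (\<Sum>i<N. real (Suc i + 1) powr c * rho a (p ^ Suc i) / real (p ^ Suc i))"
      by (subst sum.atMost_shift) simp
    also have "\<dots> \<le> 1 + (\<Sum>i<N. 2 / p * s i)"
      by (intro add_left_mono sum_mono term_le)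
    also have "\<dots> = 1 + 2 / p * (\<Sum>i<N. s i)" by (simp add: sum_distrib_left)
    also have "\<dots> \<le> 1 + 2 / p * suminf s"
      using p2 summ s0 by (intro add_left_mono mult_left_mono sum_le_suminf) auto
    also have "\<dots> \<le> 1 + K / p"
      using p2 K by (simp add: divide_right_mono)
    finally show ?thesis .
  qed
  then show ?thesis by blast
qed

text \<open>
  The left side is at most \<open>1 + (1 + \<chi>)/(p - 1)\<close> by a geometric series. For \<open>\<chi> = 1\<close> the claim is
  \<open>(p + 1)/(p - 1) \<le> p\<^sup>2/(p - 1)\<^sup>2\<close>, that is \<open>p\<^sup>2 - 1 \<le> p\<^sup>2\<close>.
\<close>

lemma unramified_factor_le:
  assumes "prime p" "\<not> p dvd 2 * j"
  shows "(\<Sum>m\<le>N. real (rho (int j) (p ^ m)) / real (p ^ m))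
           \<le> inverse (1 - 1 / real p) * inverse (1 - of_int (chi j p) / real p)"
proof -
  define e where "e = real_of_int (chi j p)"
  have p3: "real p \<ge> 2" using prime_ge_2_nat[OF assms(1)] by simp
  have le: "real (rho (int j) (p ^ m)) \<le> 1 + e" if "m > 0" for m
    using rho_prime_power_le_chi[OF assms that] unfolding e_def by linarith
  have e: "e \<in> {-1, 0, 1}" using chi_prime_cases[OF assms(1), of j] by (auto simp: e_def)
  have "(\<Sum>m\<le>N. real (rho (int j) (p ^ m)) / real (p ^ m))
          = 1 + (\<Sum>i<N. real (rho (int j) (p ^ Suc i)) / real (p ^ Suc i))"
    by (subst sum.atMost_shift) simp
  also have "\<dots> \<le> 1 + (\<Sum>i<N. (1 + e) / real p * (1 / real p) ^ i)"
  proof (intro add_left_mono sum_mono)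
    fix i
    have "real (rho (int j) (p ^ Suc i)) / real (p ^ Suc i) \<le> (1 + e) / real (p ^ Suc i)"
      using le[of "Suc i"] by (intro divide_right_mono) auto
    then show "real (rho (int j) (p ^ Suc i)) / real (p ^ Suc i) \<le> (1 + e) / real p * (1 / real p) ^ i"
      by (simp add: field_simps)
  qed
  also have "\<dots> = 1 + (1 + e) / real p * (\<Sum>i<N. (1 / real p) ^ i)" by (simp add: sum_distrib_left)
  also have "\<dots> \<le> 1 + (1 + e) / real p * (1 / (1 - 1 / real p))"
  proof (intro add_left_mono mult_left_mono)
    have "(\<Sum>i<N. (1 / real p) ^ i) \<le> suminf (\<lambda>i. (1 / real p) ^ i)"
      using p3 by (intro sum_le_suminf summable_geometric) auto
    then show "(\<Sum>i<N. (1 / real p) ^ i) \<le> 1 / (1 - 1 / real p)"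
      using p3 by (simp add: suminf_geometric)
  qed (use e in auto)
  also have "\<dots> \<le> inverse (1 - 1 / real p) * inverse (1 - e / real p)"
  proof -
    consider "e = -1" | "e = 0" | "e = 1" using e by auto
    then show ?thesis
    proof cases
      case 1
      have "0 < (1 - 1 / real p) * (1 + 1 / real p)" using p3 by (intro mult_pos_pos add_pos_nonneg) auto
      moreover have "(1 - 1 / real p) * (1 + 1 / real p) \<le> 1" by (simp add: algebra_simps)
      ultimately show ?thesis
        using 1 one_le_inverse_iff[of "(1 - 1 / real p) * (1 + 1 / real p)"] by simp
    next
      case 2
      then show ?thesis using p3 by (simp add: field_simps)
    next
      case 3
      define y where "y = 1 - 1 / real p"
      have y: "y > 0" "1 / real p = 1 - y" using p3 by (auto simp: y_def)
      have "0 \<le> (1 - y)\<^sup>2" by simp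
      then have "(2 - y) * y \<le> 1" by (simp add: power2_eq_square algebra_simps)
      then have "(2 - y) * y / (y * y) \<le> 1 / (y * y)" using y by (intro divide_right_mono) auto
      moreover have "(2 - y) * y / (y * y) = 1 + 2 * (1 - y) * (1 / y)"
        using y(1) by (simp add: field_simps)
      ultimately have "1 + 2 * (1 / real p) * (1 / y) \<le> inverse y * inverse y"
        unfolding y(2) by (simp add: divide_inverse)
      then show ?thesis using 3 by (simp add: y_def)
    qed
  qed
  finally show ?thesis unfolding e_def .
qed

text \<open>
  Bernoulli's inequality absorbs \<open>1 + K/p\<close> into \<open>(1 + 1/p)\<^sup>K\<close>. The additional factor
  \<open>1 + 1/p\<close> makes up for the Euler factor of \<open>\<chi>\<close>, which may be as small as \<open>(1 + 1/p)\<^sup>-\<^sup>1\<close>.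
\<close>

lemma ramified_factor_le:
  assumes "prime p"
  shows "1 + real K / real p \<le> inverse (1 - 1 / real p) * inverse (1 - of_int (chi j p) / real p)
           * (1 + 1 / real p) powr (real K + 1)"
proof -
  define e x where "e = real_of_int (chi j p)" and "x = 1 / real p"
  have x: "0 < x" "x < 1" using prime_gt_1_nat[OF assms(1)] by (auto simp: x_def)
  have e: "e \<in> {-1, 0, 1}" using chi_prime_cases[OF assms(1), of j] by (auto simp: e_def)
  have "1 - x \<le> 1" "1 - e * x \<le> 1 + x" "0 < 1 - e * x" using e x by auto
  then have "(1 - x) * (1 - e * x) \<le> 1 * (1 + x)" using x by (intro mult_mono) auto
  then have *: "1 \<le> inverse (1 - x) * inverse (1 - e * x) * (1 + x)"
    using x \<open>0 < 1 - e * x\<close> le_divide_eq_1_pos[of "(1 - x) * (1 - e * x)" "1 + x"]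
    by (simp add: divide_inverse mult.commute)
  have "1 + real K * x \<le> (1 + x) powr K"
    using Bernoulli_inequality[of x K] x by (simp add: powr_realpow mult.commute)
  also have "\<dots> \<le> (inverse (1 - x) * inverse (1 - e * x) * (1 + x)) * (1 + x) powr K"
    using mult_right_mono[OF *, of "(1 + x) powr K"] by simp
  also have "\<dots> = inverse (1 - x) * inverse (1 - e * x) * (1 + x) powr (real K + 1)"
    using x by (simp add: powr_add)
  finally show ?thesis by (simp add: e_def x_def)
qed

section \<open>Euler product bounds for the sums over the interval\<close>

lemma weighted_rho_sum_le_prod:
  assumes "c \<ge> 0"
  shows "(\<Sum>d=1..N. real (tau d) powr c * rho a d / d)
           \<le> (\<Prod>p\<in>primes_upto N. \<Sum>m\<le>N. real (m + 1) powr c * rho a (p ^ m) / real (p ^ m))"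
proof -
  let ?f = "\<lambda>d. real (tau d) powr c * rho a d / d"
  have "(\<Sum>d=1..N. ?f d) \<le> (\<Prod>p\<in>primes_upto N. \<Sum>m\<le>N. ?f (p ^ m))"
  proof (rule sum_le_euler_product[where f = ?f])
    fix d e :: nat assume de: "d > 0" "e > 0" "coprime d e"
    have "real (tau (d * e)) powr c \<le> (real (tau d) * real (tau e)) powr c"
      using tau_mult_le[OF de(1,2)] assms by (intro powr_mono2) (auto simp flip: of_nat_mult)
    also have "\<dots> = real (tau d) powr c * real (tau e) powr c" by (simp add: powr_mult)
    finally have "real (tau (d * e)) powr c * real (rho a (d * e))
        \<le> (real (tau d) powr c * real (tau e) powr c) * (real (rho a d) * real (rho a e))"
      using rho_mult_le[OF de] by (intro mult_mono) (auto simp flip: of_nat_mult)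
    then show "?f (d * e) \<le> ?f d * ?f e"
      using de by (simp add: divide_right_mono mult_ac)
  qed (auto simp: tau_def)
  also have "\<dots> = (\<Prod>p\<in>primes_upto N. \<Sum>m\<le>N. real (m + 1) powr c * rho a (p ^ m) / real (p ^ m))"
    by (intro prod.cong sum.cong) (auto simp: tau_prime_power)
  finally show ?thesis .
qed

text \<open>
  The common form of both parts: \<open>F = \<tau>\<^sup>B\<close> is dominated with \<open>c = 2 B\<close>, and \<open>F = \<tau>\<close> with
  \<open>c = 0\<close>, where the sum just counts the small divisors.
\<close>

lemma window_sum_le_euler_product:
  fixes M c A :: real and F :: "nat \<Rightarrow> real"
  assumes "M \<ge> 1" "c \<ge> 0" "A \<ge> 0"
    and F: "\<And>n. n > 0 \<Longrightarrow> F n \<le> A * (\<Sum>d | d dvd n \<and> d\<^sup>2 \<le> n. real (tau d) powr c)"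
  shows "(\<Sum>k\<in>{k::int. M < of_int k \<and> of_int k \<le> 2 * M \<and> k\<^sup>2 > int j}. F (nat (k\<^sup>2 - int j)))
           \<le> 3 * A * M * (\<Prod>p\<in>primes_upto (nat \<lfloor>2 * M\<rfloor>). \<Sum>m\<le>nat \<lfloor>2 * M\<rfloor>.
                  real (m + 1) powr c * rho (int j) (p ^ m) / real (p ^ m))"
proof -
  let ?W = "{k::int. M < of_int k \<and> of_int k \<le> 2 * M \<and> k\<^sup>2 > int j}"
  have "(\<Sum>k\<in>?W. F (nat (k\<^sup>2 - int j)))
      \<le> (\<Sum>k\<in>?W. A * (\<Sum>d | d dvd nat (k\<^sup>2 - int j) \<and> d\<^sup>2 \<le> nat (k\<^sup>2 - int j). real (tau d) powr c))"
    by (intro sum_mono F) auto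
  also have "\<dots> \<le> A * (3 * M * (\<Sum>d=1..nat \<lfloor>2 * M\<rfloor>. real (tau d) powr c * rho (int j) d / d))"
    unfolding sum_distrib_left[symmetric]
    using assms by (intro mult_left_mono divisor_sum_window_le) auto
  also have "\<dots> \<le> A * (3 * M * (\<Prod>p\<in>primes_upto (nat \<lfloor>2 * M\<rfloor>). \<Sum>m\<le>nat \<lfloor>2 * M\<rfloor>.
                  real (m + 1) powr c * rho (int j) (p ^ m) / real (p ^ m)))"
    using assms by (intro mult_left_mono weighted_rho_sum_le_prod) auto
  finally show ?thesis by (simp add: mult_ac)
qed

lemma frakD_ge_1: "C \<ge> 0 \<Longrightarrow> frakD C n \<ge> 1"
  unfolding frakD_def by (intro prod_ge_1 ge_one_powr_ge_zero) auto

theorem theorem8p7: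
  fixes B :: real
  assumes "B \<ge> 1"
  shows "\<exists>C C' :: real. C' \<ge> 0 \<and>
    (\<exists>K > 0. \<forall>(j::nat) (M::real).
       j \<ge> 1 \<longrightarrow> \<not> is_square j \<longrightarrow> M \<ge> 2 \<longrightarrow>
       (\<exists>k::int. M < of_int k \<and> of_int k \<le> 2 * M \<and> k\<^sup>2 > int j) \<longrightarrow>
       (\<Sum>k\<in>{k::int. M < of_int k \<and> of_int k \<le> 2 * M \<and> k\<^sup>2 > int j}.
           real (tau (nat (k\<^sup>2 - int j))) powr B)
         \<le> K * (M * ln (2 * M) powr C * frakD C' j)) \<and>
    (B = 1 \<longrightarrow>
     (\<exists>K > 0. \<forall>(j::nat) (M::real).
       j \<ge> 1 \<longrightarrow> \<not> is_square j \<longrightarrow> M \<ge> 2 \<longrightarrow>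
       (\<exists>k::int. M < of_int k \<and> of_int k \<le> 2 * M \<and> k\<^sup>2 > int j) \<longrightarrow>
       (\<Sum>k\<in>{k::int. M < of_int k \<and> of_int k \<le> 2 * M \<and> k\<^sup>2 > int j}.
           real (tau (nat (k\<^sup>2 - int j))))
         \<le> K * (M * ln (2 * M) * frakD C' j * L_trunc (2 * M) (chi j))))"
proof -
  obtain Ka :: nat where local_a: "\<And>p a N. prime p \<Longrightarrow>
      (\<Sum>m\<le>N. real (m + 1) powr (2 * B) * rho a (p ^ m) / real (p ^ m)) \<le> 1 + Ka / real p"
    using local_factor_le[of "2 * B"] by blast
  obtain Kb :: nat where local_b: "\<And>p a N. prime p \<Longrightarrow>
      (\<Sum>m\<le>N. real (m + 1) powr 0 * rho a (p ^ m) / real (p ^ m)) \<le> 1 + Kb / real p"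
    using local_factor_le[of 0] by blast
  define D where "D = 3 - ln (ln (2::real))"
  have cutoff: "nat \<lfloor>2 * M\<rfloor> \<ge> 2" "ln (real (nat \<lfloor>2 * M\<rfloor>)) \<le> ln (2 * M)" if "M \<ge> 2" for M :: real
  proof -
    show 2: "nat \<lfloor>2 * M\<rfloor> \<ge> 2" using that by (simp add: le_nat_iff le_floor_iff)
    have "real (nat \<lfloor>2 * M\<rfloor>) \<le> 2 * M" using that by simp
    then show "ln (real (nat \<lfloor>2 * M\<rfloor>)) \<le> ln (2 * M)" using 2 by (intro ln_mono) auto
  qed
  have a: "(\<Sum>k\<in>{k::int. M < of_int k \<and> of_int k \<le> 2 * M \<and> k\<^sup>2 > int j}.
             real (tau (nat (k\<^sup>2 - int j))) powr B)
         \<le> (3 * 2 powr B * exp (Ka * D)) * (M * ln (2 * M) powr Ka * frakD (real Kb + 1) j)"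
    if M: "M \<ge> 2" for j :: nat and M :: real
  proof -
    define N where "N = nat \<lfloor>2 * M\<rfloor>"
    have N: "N \<ge> 2" "ln (real N) \<le> ln (2 * M)" using cutoff[OF M] by (auto simp: N_def)
    have lnN: "ln (real N) > 0" using N by simp
    have "(\<Sum>k\<in>{k::int. M < of_int k \<and> of_int k \<le> 2 * M \<and> k\<^sup>2 > int j}.
             real (tau (nat (k\<^sup>2 - int j))) powr B)
         \<le> 3 * 2 powr B * M * (\<Prod>p\<in>primes_upto N. \<Sum>m\<le>N.
                  real (m + 1) powr (2 * B) * rho (int j) (p ^ m) / real (p ^ m))"
      unfolding N_def using M assms
      by (intro window_sum_le_euler_product tau_powr_le_small_divisor_sum) auto
    also have "\<dots> \<le> 3 * 2 powr B * M * (\<Prod>p\<in>primes_upto N. exp (Ka * (1 / real p)))"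
    proof (intro mult_left_mono prod_mono conjI sum_nonneg)
      fix p assume "p \<in> primes_upto N"
      then have "(\<Sum>m\<le>N. real (m + 1) powr (2 * B) * rho (int j) (p ^ m) / real (p ^ m))
                   \<le> 1 + Ka * (1 / real p)"
        using local_a[of p "int j" N] by simp
      also have "\<dots> \<le> exp (Ka * (1 / real p))" by (rule exp_ge_add_one_self)
      finally show "(\<Sum>m\<le>N. real (m + 1) powr (2 * B) * rho (int j) (p ^ m) / real (p ^ m))
                   \<le> exp (Ka * (1 / real p))" .
    qed (use M in auto)
    also have "\<dots> = 3 * 2 powr B * M * exp (Ka * (\<Sum>p\<in>primes_upto N. 1 / real p))"
      by (simp add: exp_sum sum_distrib_left)
    also have "\<dots> \<le> 3 * 2 powr B * M * exp (Ka * (ln (ln (real N)) + D))"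
      using sum_inverse_primes_le[OF N(1)] M
      by (intro mult_left_mono iffD2[OF exp_le_cancel_iff]) (auto simp: D_def)
    also have "\<dots> = 3 * 2 powr B * exp (Ka * D) * (M * ln (real N) powr Ka * 1)"
      using lnN by (simp add: powr_def exp_add[symmetric] algebra_simps)
    also have "\<dots> \<le> 3 * 2 powr B * exp (Ka * D) * (M * ln (2 * M) powr Ka * frakD (real Kb + 1) j)"
      using M N lnN frakD_ge_1[of "real Kb + 1" j]
      by (intro mult_left_mono mult_mono powr_mono2) auto
    finally show ?thesis .
  qed
  have b: "(\<Sum>k\<in>{k::int. M < of_int k \<and> of_int k \<le> 2 * M \<and> k\<^sup>2 > int j}.
             real (tau (nat (k\<^sup>2 - int j))))
         \<le> (6 * exp (4 - ln (ln 2))) * (M * ln (2 * M) * frakD (real Kb + 1) j * L_trunc (2 * M) (chi j))"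
    if M: "M \<ge> 2" and j: "j \<ge> 1" for j :: nat and M :: real
  proof -
    define N where "N = nat \<lfloor>2 * M\<rfloor>"
    have N: "N \<ge> 2" "ln (real N) \<le> ln (2 * M)" using cutoff[OF M] by (auto simp: N_def)
    have primes: "{p. prime p \<and> real p \<le> 2 * M} = primes_upto N"
      using M by (auto simp: N_def le_nat_iff le_floor_iff)
    define E where "E = (\<lambda>p. inverse (1 - real_of_int (chi j p) / real p))"
    \<comment> \<open>\<open>R\<close> is the loss at \<open>p\<close>; its product over all primes up to \<open>2 M\<close> is part of \<open>frakD\<close>.\<close>
    define R where "R = (\<lambda>p. if p dvd 2 * j then (1 + 1 / real p) powr (real Kb + 1) else 1)"
    have L: "prod E (primes_upto N) = L_trunc (2 * M) (chi j)"
      unfolding L_trunc_def primes E_def ..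
    have E: "E p > 0" if "prime p" for p
      using chi_prime_cases[OF that, of j] prime_gt_1_nat[OF that] by (auto simp: E_def)
    have R: "R p \<ge> 1" for p
      by (auto simp: R_def intro!: ge_one_powr_ge_zero)
    have tau_le: "real (tau n) \<le> 2 * (\<Sum>d | d dvd n \<and> d\<^sup>2 \<le> n. real (tau d) powr 0)" if "n > 0" for n
    proof -
      have "tau d > 0" if "d dvd n" for d
        using that \<open>n > 0\<close> by (auto simp: tau_def card_gt_0_iff intro!: finite_divisors_nat Nat.gr0I)
      then have "(\<Sum>d | d dvd n \<and> d\<^sup>2 \<le> n. real (tau d) powr 0) = (\<Sum>d | d dvd n \<and> d\<^sup>2 \<le> n. 1)"
        by (intro sum.cong) fastforce+
      then show ?thesis using tau_le_small_divisors[OF that] by simp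
    qed
    have "(\<Sum>k\<in>{k::int. M < of_int k \<and> of_int k \<le> 2 * M \<and> k\<^sup>2 > int j}.
             real (tau (nat (k\<^sup>2 - int j))))
         \<le> 3 * 2 * M * (\<Prod>p\<in>primes_upto N. \<Sum>m\<le>N.
                  real (m + 1) powr 0 * rho (int j) (p ^ m) / real (p ^ m))"
      unfolding N_def using M tau_le by (intro window_sum_le_euler_product) auto
    also have "\<dots> \<le> 3 * 2 * M * (\<Prod>p\<in>primes_upto N. inverse (1 - 1 / real p) * E p * R p)"
    proof (intro mult_left_mono prod_mono conjI sum_nonneg)
      fix p assume "p \<in> primes_upto N"
      then have p: "prime p" by simp
      show "(\<Sum>m\<le>N. real (m + 1) powr 0 * rho (int j) (p ^ m) / real (p ^ m))
              \<le> inverse (1 - 1 / real p) * E p * R p"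
      proof (cases "p dvd 2 * j")
        case True
        then show ?thesis
          using order_trans[OF local_b[OF p] ramified_factor_le[OF p]]
          by (simp add: R_def E_def)
      next
        case False
        then show ?thesis
          using unramified_factor_le[OF p False, of N] by (simp add: R_def E_def)
      qed
    qed (use M in auto)
    also have "\<dots> = 6 * M * ((\<Prod>p\<in>primes_upto N. inverse (1 - 1 / real p)) * prod E (primes_upto N)
                       * prod R (primes_upto N))"
      by (simp add: prod.distrib)
    also have "\<dots> \<le> 6 * M * ((exp (4 - ln (ln 2)) * ln (2 * M)) * prod E (primes_upto N)
                       * frakD (real Kb + 1) j)"
    proof (intro mult_left_mono mult_mono)
      show "(\<Prod>p\<in>primes_upto N. inverse (1 - 1 / real p)) \<le> exp (4 - ln (ln 2)) * ln (2 * M)"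
        using mertens_product_le[OF N(1)] N(2) by (meson exp_ge_zero mult_left_mono order_trans)
      have "prod R (primes_upto N) = prod R {p \<in> primes_upto N. p dvd 2 * j}"
        by (intro prod.mono_neutral_right) (auto simp: R_def)
      also have "\<dots> \<le> prod R (prime_factors (2 * j))"
        using j R by (intro prod_mono2) (auto simp: in_prime_factors_iff intro: order_trans[OF zero_le_one])
      also have "\<dots> = frakD (real Kb + 1) j"
        unfolding frakD_def by (intro prod.cong) (auto simp: R_def)
      finally show "prod R (primes_upto N) \<le> frakD (real Kb + 1) j" .
      show "0 \<le> prod R (primes_upto N)" using R by (intro prod_nonneg) (meson order_trans zero_le_one)
      show "0 \<le> prod E (primes_upto N)" using E by (intro prod_nonneg) (auto intro: less_imp_le)
      then show "0 \<le> exp (4 - ln (ln 2)) * ln (2 * M) * prod E (primes_upto N)"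
        using M by simp
    qed (use M in auto)
    also have "\<dots> = (6 * exp (4 - ln (ln 2))) * (M * ln (2 * M) * frakD (real Kb + 1) j * L_trunc (2 * M) (chi j))"
      by (simp add: L mult_ac)
    finally show ?thesis .
  qed
  show ?thesis
  proof (rule exI[of _ "real Ka"], rule exI[of _ "real Kb + 1"], intro conjI impI)
    show "\<exists>K > 0. \<forall>(j::nat) (M::real).
       j \<ge> 1 \<longrightarrow> \<not> is_square j \<longrightarrow> M \<ge> 2 \<longrightarrow>
       (\<exists>k::int. M < of_int k \<and> of_int k \<le> 2 * M \<and> k\<^sup>2 > int j) \<longrightarrow>
       (\<Sum>k\<in>{k::int. M < of_int k \<and> of_int k \<le> 2 * M \<and> k\<^sup>2 > int j}.
           real (tau (nat (k\<^sup>2 - int j))) powr B)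
         \<le> K * (M * ln (2 * M) powr Ka * frakD (real Kb + 1) j)"
      using a by (intro exI[of _ "3 * 2 powr B * exp (Ka * D)"]) auto
    show "\<exists>K > 0. \<forall>(j::nat) (M::real).
       j \<ge> 1 \<longrightarrow> \<not> is_square j \<longrightarrow> M \<ge> 2 \<longrightarrow>
       (\<exists>k::int. M < of_int k \<and> of_int k \<le> 2 * M \<and> k\<^sup>2 > int j) \<longrightarrow>
       (\<Sum>k\<in>{k::int. M < of_int k \<and> of_int k \<le> 2 * M \<and> k\<^sup>2 > int j}.
           real (tau (nat (k\<^sup>2 - int j))))
         \<le> K * (M * ln (2 * M) * frakD (real Kb + 1) j * L_trunc (2 * M) (chi j))"
      using b by (intro exI[of _ "6 * exp (4 - ln (ln 2))"]) auto
  qed auto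
qed

end
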